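(* (Countable $F$-saturation Principle.) Let $F\in\mathfrak{F}$ and let $\{X^i\}_{i\in\omega}$ be a countable family of internal predicates such that for any $k\in\omega$, $F\Vdash\exists x\,X^k(x)$ and $F\Vdash\forall x(X^{k+1}(x)\to X^k(x))$. Then there is $a\in{}^\dagger\mathcal{R}$ such that $F\Vdash X^k(a)$ for all $k\in\omega$.
   Context: Background theory: ZF + Dependent Choices. The Fréchet filter $F_0$ is the filter of cofinite subsets of $\omega$; $\mathfrak{F}$ is the set of all proper filters on $\omega$ extending $F_0$. The $F$-hyperreal line ${}^\dagger\mathcal{R}$ is the possibility structure with set of viewpoints $\mathfrak{F}$ (ordered by reverse inclusion) and domain $\mathbb{R}^\omega$, the set of functions $\omega\to\mathbb{R}$. Its language has in particular a unary predicate symbol $X$ (an internal predicate) for each sequence $\{X_n\}_{n\in\omega}$ of subsets of $\mathbb{R}$; its extension at $F$ is the $F$-internal set $X_F=\{a\in\mathbb{R}^\omega:\{n\in\omega:a(n)\in X_n\}\in F\}$. The forcing relation for the formulas concerned is given, for $F\in\mathfrak{F}$, by: - $F\Vdash X(a)$ iff $\{n\in\omega:a(n)\in X_n\}\in F$; - $F\Vdash\psi\to\chi$ iff for all $G\supseteq F$ in $\mathfrak{F}$, $G\Vdash\psi$ implies $G\Vdash\chi$; - $F\Vdash\forall x\psi$ iff $F\Vdash\psi(b)$ for all $b\in\mathbb{R}^\omega$; - $F\Vdash\exists x\psi$ iff for all $G\supseteq F$ in $\mathfrak{F}$ there are $H\supseteq G$ in $\mathfrak{F}$ and $b\in\mathbb{R}^\omega$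 with $H\Vdash\psi(b)$. Thus each $X^k$ is given by a sequence $\{X^k_n\}_{n\in\omega}$ of subsets of $\mathbb{R}$. *)

theory Defs
  imports Complex_Main
begin

text \<open>
  Filters on \<open>\<omega>\<close> are the library's filters on \<^typ>\<open>nat\<close>: a set \<open>S\<close> belongs to the filter \<open>F\<close>
  iff \<open>eventually (\<lambda>n. n \<in> S) F\<close>.  The library order is reverse inclusion, i.e. \<open>G \<le> F\<close> says
  that \<open>G\<close> contains every set in \<open>F\<close>, and the improper filter is \<open>bot\<close>.
\<close>

text \<open>Proper filters extending the Frechet filter \<^const>\<open>cofinite\<close>.\<close>

definition viewpoints :: "nat filter set" where
  "viewpoints = {F. F \<noteq> bot \<and> F \<le> cofinite}"

type_synonym hyperreal = "nat \<Rightarrow> real"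

type_synonym internal_pred = "nat \<Rightarrow> real set"

definition internal_set :: "nat filter \<Rightarrow> internal_pred \<Rightarrow> hyperreal set" where
  "internal_set F X = {a. eventually (\<lambda>n. a n \<in> X n) F}"

text \<open>
  The fragment of the language built from unary internal predicates, with the elements of the
  domain available as parameters.
\<close>

datatype trm = Var nat | Par hyperreal

datatype fm =
    Pred internal_pred trm
  | Imp fm fm
  | Forall nat fm
  | Exists nat fm

fun subst_trm :: "nat \<Rightarrow> hyperreal \<Rightarrow> trm \<Rightarrow> trm" where
  "subst_trm x b (Var y) = (if x = y then Par b else Var y)"
| "subst_trm x b (Par a) = Par a"

text \<open>Parameters are closed, so substituting one for the free occurrences of \<open>x\<close> cannot capture.\<close>

fun subst :: "nat \<Rightarrow> hyperreal \<Rightarrow> fm \<Rightarrow> fm" where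
  "subst x b (Pred X t) = Pred X (subst_trm x b t)"
| "subst x b (Imp \<psi> \<chi>) = Imp (subst x b \<psi>) (subst x b \<chi>)"
| "subst x b (Forall y \<psi>) = Forall y (if x = y then \<psi> else subst x b \<psi>)"
| "subst x b (Exists y \<psi>) = Exists y (if x = y then \<psi> else subst x b \<psi>)"

lemma size_subst [simp]: "size (subst x b \<phi>) = size \<phi>"
  by (induction \<phi>) auto

text \<open>
  Forcing is meant for sentences (with parameters).  Atoms with a free variable, which never arise
  when a sentence is evaluated, are given the value \<^const>\<open>False\<close>.
\<close>

function forces :: "nat filter \<Rightarrow> fm \<Rightarrow> bool" (infix "\<tturnstile>" 50) where
  "F \<tturnstile> Pred X (Par a) \<longleftrightarrow> a \<in> internal_set F X"
| "F \<tturnstile> Pred X (Var x) \<longleftrightarrow> False"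
| "F \<tturnstile> Imp \<psi> \<chi> \<longleftrightarrow> (\<forall>G\<in>viewpoints. G \<le> F \<longrightarrow> G \<tturnstile> \<psi> \<longrightarrow> G \<tturnstile> \<chi>)"
| "F \<tturnstile> Forall x \<psi> \<longleftrightarrow> (\<forall>b. F \<tturnstile> subst x b \<psi>)"
| "F \<tturnstile> Exists x \<psi> \<longleftrightarrow>
     (\<forall>G\<in>viewpoints. G \<le> F \<longrightarrow> (\<exists>H\<in>viewpoints. H \<le> G \<and> (\<exists>b. H \<tturnstile> subst x b \<psi>)))"
  by pat_completeness auto
termination by (relation "measure (\<lambda>(F, \<phi>). size \<phi>)") auto

end

theory Submission imports Defs begin

text \<open>
  Both forcing hypotheses can be read coordinatewise.  A statement that fails to hold
  \<open>F\<close>-eventually holds throughout some viewpoint \<open>G \<le> F\<close>: restrict \<open>F\<close> to the set of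
  counterexamples.  As the clauses for \<^const>\<open>Exists\<close> and \<^const>\<open>Imp\<close> quantify over all such
  \<open>G\<close>, the hypotheses force \<open>X k n\<close> to be nonempty and \<open>X (Suc k) n\<close> to be a subset of \<open>X k n\<close>
  for \<open>F\<close>-almost all \<open>n\<close> (lemmas \<open>eventually_nonempty_if_forces_Exists\<close> and
  \<open>eventually_subset_if_forces_Forall_Imp\<close>).

  Hence, for each fixed \<open>k\<close>, the sets \<open>X 0 n, \<dots>, X k n\<close> have a common point for \<open>F\<close>-almost all
  \<open>n\<close>.  What remains is the diagonal argument known from the countable saturation of ultrapowers
  (lemma \<open>diagonal_selection\<close>): at coordinate \<open>n\<close>, choose a point common to as many of the first
  sets as possible, but looking at the indices up to \<open>n\<close> only.  The bound \<open>n\<close> makes the maximum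
  exist, and it is harmless because \<open>F\<close> contains the cofinite sets, so that \<open>k \<le> n\<close> holds
  eventually for each \<open>k\<close>. 
\<close>

text \<open>
  The refinement is \<open>F\<close> restricted to the complement of \<open>P\<close>; it is proper exactly because \<open>P\<close>
  does not belong to \<open>F\<close>.
\<close>

lemma viewpoint_refuting:
  assumes "F \<in> viewpoints" and "\<not> eventually P F"
  obtains G where "G \<in> viewpoints" "G \<le> F" "eventually (\<lambda>n. \<not> P n) G"
proof
  let ?G = "inf F (principal {n. \<not> P n})"
  have "?G \<noteq> bot"
    using assms(2) by (simp add: trivial_limit_def eventually_inf_principal)
  then show "?G \<in> viewpoints"
    using assms(1) by (auto simp: viewpoints_def intro: le_infI1)
  show "?G \<le> F"
    by simp
  show "eventually (\<lambda>n. \<not> P n) ?G"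
    by (simp add: eventually_inf_principal)
qed

lemma not_eventually_contradictory:
  assumes "G \<in> viewpoints" and "eventually P G" and "eventually (\<lambda>n. \<not> P n) G"
  shows False
  using eventually_conj[OF assms(2,3)] assms(1) by (simp add: viewpoints_def)

text \<open>
  On a refinement where \<open>X n\<close> is empty throughout, and so on everything below it, no element can
  be a witness, although the clause for \<^const>\<open>Exists\<close> demands one.
\<close>

lemma eventually_nonempty_if_forces_Exists:
  assumes F: "F \<in> viewpoints" and ex: "F \<tturnstile> Exists x (Pred X (Var x))"
  shows "eventually (\<lambda>n. X n \<noteq> {}) F"
proof (rule ccontr)
  assume "\<not> ?thesis"
  then obtain G where G: "G \<in> viewpoints" "G \<le> F" and empty: "eventually (\<lambda>n. \<not> X n \<noteq> {}) G"
    by (rule viewpoint_refuting[OF F])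
  then obtain H b where H: "H \<in> viewpoints" "H \<le> G" and b: "eventually (\<lambda>n. b n \<in> X n) H"
    using ex by (auto simp: internal_set_def)
  have "eventually (\<lambda>n. X n \<noteq> {}) H"
    using b by (rule eventually_mono) auto
  then show False
    using not_eventually_contradictory[OF H(1)] filter_leD[OF H(2) empty] by blast
qed

text \<open>
  A single element \<open>b\<close> tests the inclusion: let \<open>b n\<close> be a point of \<open>Y n - X n\<close> wherever there is
  one.  On a refinement where the inclusion fails everywhere, \<open>b\<close> lies in \<open>Y\<close> but not in \<open>X\<close>.
\<close>

lemma eventually_subset_if_forces_Forall_Imp:
  assumes F: "F \<in> viewpoints" and all: "F \<tturnstile> Forall x (Imp (Pred Y (Var x)) (Pred X (Var x)))"
  shows "eventually (\<lambda>n. Y n \<subseteq> X n) F"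
proof (rule ccontr)
  assume "\<not> ?thesis"
  then obtain G where G: "G \<in> viewpoints" "G \<le> F" and nsub: "eventually (\<lambda>n. \<not> Y n \<subseteq> X n) G"
    by (rule viewpoint_refuting[OF F])
  have "\<forall>n. \<exists>r. \<not> Y n \<subseteq> X n \<longrightarrow> r \<in> Y n - X n"
    by blast
  then obtain b where b: "\<And>n. \<not> Y n \<subseteq> X n \<Longrightarrow> b n \<in> Y n - X n"
    by metis
  have "eventually (\<lambda>n. b n \<in> Y n) G" and notin: "eventually (\<lambda>n. b n \<notin> X n) G"
    using b by (auto intro: eventually_mono[OF nsub])
  then have "eventually (\<lambda>n. b n \<in> X n) G"
    using all G by (simp add: internal_set_def)
  then show False
    using notin by (rule not_eventually_contradictory[OF G(1)])
qed

text \<open>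
  At coordinate \<open>n\<close> the selected point realizes the longest initial segment of the requirements
  \<open>A 0 n, A 1 n, \<dots>\<close> that is realizable and has its last index at most \<open>n\<close>.  If \<open>k \<le> n\<close> and the
  segment up to \<open>k\<close> is realizable at \<open>n\<close>, then \<open>k\<close> is one of the competitors, so the longest
  segment includes the requirement \<open>A k n\<close>.
\<close>

lemma diagonal_selection:
  fixes A :: "nat \<Rightarrow> nat \<Rightarrow> 'a set"
  assumes cof: "F \<le> cofinite"
    and common: "\<And>k. eventually (\<lambda>n. \<exists>r. \<forall>j\<le>k. r \<in> A j n) F"
  shows "\<exists>a. \<forall>k. eventually (\<lambda>n. a n \<in> A k n) F"
proof -
  have "\<exists>r. \<forall>k\<le>n. (\<exists>s. \<forall>j\<le>k. s \<in> A j n) \<longrightarrow> r \<in> A k n" for n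
  proof (cases "\<exists>k\<le>n. \<exists>s. \<forall>j\<le>k. s \<in> A j n")
    case True
    define K where "K = {k. k \<le> n \<and> (\<exists>s. \<forall>j\<le>k. s \<in> A j n)}"
    have K: "finite K" "K \<noteq> {}"
      using True by (auto simp: K_def)
    then have "Max K \<in> K"
      by (rule Max_in)
    then obtain r where "\<forall>j\<le>Max K. r \<in> A j n"
      by (auto simp: K_def)
    moreover have "k \<le> Max K" if "k \<le> n" "\<exists>s. \<forall>j\<le>k. s \<in> A j n" for k
      using that K(1) by (intro Max_ge) (auto simp: K_def)
    ultimately show ?thesis
      by blast
  qed blast
  then obtain a where a: "\<And>n k. k \<le> n \<Longrightarrow> \<exists>s. \<forall>j\<le>k. s \<in> A j n \<Longrightarrow> a n \<in> A k n"
    by metis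
  have "eventually (\<lambda>n. a n \<in> A k n) F" for k
  proof -
    have "eventually (\<lambda>n. k \<le> n) F"
      using filter_leD[OF cof] eventually_ge_at_top[of k] by (simp add: cofinite_eq_sequentially)
    with common[of k] show ?thesis
      by eventually_elim (rule a)
  qed
  then show ?thesis
    by blast
qed

theorem theorem3p15:
  fixes F :: "nat filter" and X :: "nat \<Rightarrow> internal_pred" and x :: nat
  assumes "F \<in> viewpoints"
    and "\<And>k. F \<tturnstile> Exists x (Pred (X k) (Var x))"
    and "\<And>k. F \<tturnstile> Forall x (Imp (Pred (X (Suc k)) (Var x)) (Pred (X k) (Var x)))"
  shows "\<exists>a :: hyperreal. \<forall>k. F \<tturnstile> Pred (X k) (Par a)"
proof -
  have "eventually (\<lambda>n. \<exists>r. \<forall>j\<le>k. r \<in> X j n) F" for k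
  proof -
    \<comment> \<open>Only finitely many inclusions lie below \<open>k\<close>, so they hold simultaneously in \<open>F\<close>.\<close>
    have "eventually (\<lambda>n. \<forall>j\<in>{..<k}. X (Suc j) n \<subseteq> X j n) F"
      using eventually_subset_if_forces_Forall_Imp[OF assms(1,3)]
      by (intro eventually_ball_finite) auto
    with eventually_nonempty_if_forces_Exists[OF assms(1) assms(2)[of k]] show ?thesis
    proof eventually_elim
      case (elim n)
      then obtain r where r: "r \<in> X k n"
        by blast
      have "r \<in> X j n" if "j \<le> k" for j
        using that by (induction rule: inc_induct) (use r elim(2) in auto)
      then show ?case
        by blast
    qed
  qed
  moreover have "F \<le> cofinite"
    using assms(1) by (simp add: viewpoints_def)
  ultimately have "\<exists>a. \<forall>k. eventually (\<lambda>n. a n \<in> X k n) F"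
    by (intro diagonal_selection)
  then show ?thesis
    by (simp add: internal_set_def)
qed

end
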